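(* Let $\mathcal{A}$ and $\mathcal{U}$ be Banach algebras such that $\mathcal{U}$ is a Banach $\mathcal{A}$-bimodule with compatible actions and norm. Let $D$ be a derivation on $\mathcal{A}\ltimes\mathcal{U}$ written as $$D((a,x))=(\delta_1(a)+\tau_1(x),\,\delta_2(a)+\tau_2(x))\qquad(a\in\mathcal{A},\ x\in\mathcal{U}),$$ and suppose $\delta_2(\mathcal{A})\subseteq ann_{\mathcal{U}}\mathcal{U}$. Then under any one of the following conditions, $D_1((a,x))=(\delta_1(a)+\tau_1(x),\,\tau_2(x))$ is a continuous derivation on $\mathcal{A}\ltimes\mathcal{U}$ and $D=D_1+D_2$, where $D_2((a,x))=(0,\delta_2(a))$ is a derivation on $\mathcal{A}\ltimes\mathcal{U}$: (i) $ann_{\mathcal{A}}\mathcal{U}=(0)$ and $\tau_2$ is continuous. (ii) $\mathcal{A}$ possesses a bounded right approximate identity, there is a surjective left $\mathcal{A}$-module homomorphism $\phi:\mathcal{A}\to\mathcal{U}$, and both $\delta_1$ and $\tau_1$ are continuous. (iii) $\mathcal{A}$ possesses a bounded right approximate identity, there is an injective left $\mathcal{A}$-module homomorphism $\phi:\mathcal{A}\to\mathcal{U}$, and both $\tau_1$ and $\tau_2$ are continuous.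
   Context: All algebras are over $\mathbb{C}$. "Banach $\mathcal{A}$-bimodule with compatible actions and norm" means: $\|ax\|\le\|a\|\|x\|$, $\|xa\|\le\|x\|\|a\|$, and $a(xy)=(ax)y$, $(xy)a=x(ya)$, $(xa)y=x(ay)$ for all $a\in\mathcal{A}$, $x,y\in\mathcal{U}$. The semidirect product $\mathcal{A}\ltimes\mathcal{U}$ is $\mathcal{A}\times\mathcal{U}$ with multiplication $(a,x)(b,y)=(ab,\,ay+xb+xy)$ and norm $\|(a,x)\|=\|a\|+\|x\|$. A derivation on an algebra $\mathcal{B}$ is a linear map $D:\mathcal{B}\to\mathcal{B}$ (not assumed continuous) with $D(bc)=bD(c)+D(b)c$. The linear maps $\delta_1:\mathcal{A}\to\mathcal{A}$, $\delta_2:\mathcal{A}\to\mathcal{U}$, $\tau_1:\mathcal{U}\to\mathcal{A}$, $\tau_2:\mathcal{U}\to\mathcal{U}$ are the components of $D$: $D((a,0))=(\delta_1(a),\delta_2(a))$ and $D((0,x))=(\tau_1(x),\tau_2(x))$. Further, $ann_{\mathcal{A}}\mathcal{U}=\{a\in\mathcal{A}\mid a\mathcal{U}=\mathcal{U}a=(0)\}$ and $ann_{\mathcal{U}}\mathcal{U}=\{x\in\mathcal{U}\mid x\mathcal{U}=\mathcal{U}x=(0)\}$. A left $\mathcal{A}$-module homomorphism is a linear map $\phi$ (not assumed continuous) with $\phi(ab)=a\phi(b)$ for $a,b\in\mathcal{A}$. A bounded right approximate identity of $\mathcal{A}$ is a bounded net $(e_i)$ in $\mathcal{A}$ with $ae_i\to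 a$ for all $a\in\mathcal{A}$. *)

theory Defs
  imports "HOL-Analysis.Analysis"
begin

text \<open>
  HOL-Analysis only has real normed algebras.  The complex classes below extend the real ones by a
  complex scalar multiplication that restricts to the real one.  No unit is assumed.
\<close>

class complex_vector = real_vector +
  fixes scaleC :: "complex \<Rightarrow> 'a \<Rightarrow> 'a"  (infixr \<open>*\<^sub>C\<close> 75)
  assumes scaleR_scaleC: "r *\<^sub>R x = complex_of_real r *\<^sub>C x"
    and scaleC_add_right: "c *\<^sub>C (x + y) = c *\<^sub>C x + c *\<^sub>C y"
    and scaleC_add_left: "(c + d) *\<^sub>C x = c *\<^sub>C x + d *\<^sub>C x"
    and scaleC_scaleC: "c *\<^sub>C (d *\<^sub>C x) = (c * d) *\<^sub>C x"
    and scaleC_one: "1 *\<^sub>C x = x"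

class complex_normed_vector = complex_vector + real_normed_vector +
  assumes norm_scaleC: "norm (c *\<^sub>C x) = cmod c * norm x"

class complex_banach_algebra = complex_normed_vector + real_normed_algebra + banach +
  assumes scaleC_mult_left: "(c *\<^sub>C x) * y = c *\<^sub>C (x * y)"
    and scaleC_mult_right: "x * (c *\<^sub>C y) = c *\<^sub>C (x * y)"

abbreviation clinear :: "('a::complex_vector \<Rightarrow> 'b::complex_vector) \<Rightarrow> bool"
  where "clinear \<equiv> Vector_Spaces.linear scaleC scaleC"

locale compatible_banach_bimodule =
  fixes lact :: "'a::complex_banach_algebra \<Rightarrow> 'u::complex_banach_algebra \<Rightarrow> 'u"  (infixl \<open>\<rhd>\<close> 70)
    and ract :: "'u \<Rightarrow> 'a \<Rightarrow> 'u"  (infixl \<open>\<lhd>\<close> 70)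
  assumes lact_clinear_left: "clinear (\<lambda>a. a \<rhd> x)"
    and lact_clinear_right: "clinear (\<lambda>x. a \<rhd> x)"
    and ract_clinear_left: "clinear (\<lambda>x. x \<lhd> a)"
    and ract_clinear_right: "clinear (\<lambda>a. x \<lhd> a)"
    and lact_assoc: "(a * b) \<rhd> x = a \<rhd> (b \<rhd> x)"
    and ract_assoc: "x \<lhd> (a * b) = (x \<lhd> a) \<lhd> b"
    and lact_ract_assoc: "(a \<rhd> x) \<lhd> b = a \<rhd> (x \<lhd> b)"
    and norm_lact: "norm (a \<rhd> x) \<le> norm a * norm x"
    and norm_ract: "norm (x \<lhd> a) \<le> norm x * norm a"
    and lact_mult: "a \<rhd> (x * y) = (a \<rhd> x) * y"
    and mult_ract: "(x * y) \<lhd> a = x * (y \<lhd> a)"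
    and ract_mult: "(x \<lhd> a) * y = x * (a \<rhd> y)"

text \<open>
  The underlying normed space of the semidirect product.  It is a type of its own, because the
  library norm on the type of pairs is the Euclidean combination and not the sum of the norms.
  The multiplication depends on the two actions, so it is a separate function \<open>semidirect_mult\<close>.
\<close>

datatype ('a, 'u) semidirect = Semi (sd_fst: 'a) (sd_snd: 'u)

instantiation semidirect :: (complex_vector, complex_vector) complex_vector
begin

definition zero_semidirect :: "('a, 'b) semidirect"
  where "0 = Semi 0 0"
definition plus_semidirect :: "('a, 'b) semidirect \<Rightarrow> ('a, 'b) semidirect \<Rightarrow> ('a, 'b) semidirect"
  where "p + q = Semi (sd_fst p + sd_fst q) (sd_snd p + sd_snd q)"
definition minus_semidirect :: "('a, 'b) semidirect \<Rightarrow> ('a, 'b) semidirect \<Rightarrow> ('a, 'b) semidirect"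
  where "p - q = Semi (sd_fst p - sd_fst q) (sd_snd p - sd_snd q)"
definition uminus_semidirect :: "('a, 'b) semidirect \<Rightarrow> ('a, 'b) semidirect"
  where "- p = Semi (- sd_fst p) (- sd_snd p)"
definition scaleR_semidirect :: "real \<Rightarrow> ('a, 'b) semidirect \<Rightarrow> ('a, 'b) semidirect"
  where "r *\<^sub>R p = Semi (r *\<^sub>R sd_fst p) (r *\<^sub>R sd_snd p)"
definition scaleC_semidirect :: "complex \<Rightarrow> ('a, 'b) semidirect \<Rightarrow> ('a, 'b) semidirect"
  where "c *\<^sub>C p = Semi (c *\<^sub>C sd_fst p) (c *\<^sub>C sd_snd p)"

instance
  by standard
    (auto simp: zero_semidirect_def plus_semidirect_def minus_semidirect_def uminus_semidirect_def
      scaleR_semidirect_def scaleC_semidirect_def algebra_simps scaleR_scaleC[symmetric]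
      scaleC_add_right scaleC_add_left scaleC_scaleC scaleC_one)

end

instantiation semidirect :: (complex_normed_vector, complex_normed_vector) complex_normed_vector
begin

definition norm_semidirect :: "('a, 'b) semidirect \<Rightarrow> real"
  where "norm_semidirect p = norm (sd_fst p) + norm (sd_snd p)"
definition dist_semidirect :: "('a, 'b) semidirect \<Rightarrow> ('a, 'b) semidirect \<Rightarrow> real"
  where "dist_semidirect p q = norm (p - q)"
definition sgn_semidirect :: "('a, 'b) semidirect \<Rightarrow> ('a, 'b) semidirect"
  where "sgn_semidirect p = inverse (norm p) *\<^sub>R p"
definition uniformity_semidirect :: "(('a, 'b) semidirect \<times> ('a, 'b) semidirect) filter"
  where "uniformity_semidirect = (INF e\<in>{0<..}. principal {(p, q). dist p q < e})"
definition open_semidirect :: "('a, 'b) semidirect set \<Rightarrow> bool"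
  where "open_semidirect S \<longleftrightarrow> (\<forall>p\<in>S. \<forall>\<^sub>F (p', q) in uniformity. p' = p \<longrightarrow> q \<in> S)"

instance
proof
  fix p q :: "('a, 'b) semidirect" and r :: real and c :: complex
  show "norm p = 0 \<longleftrightarrow> p = 0"
    by (cases p) (auto simp: norm_semidirect_def zero_semidirect_def add_nonneg_eq_0_iff)
  show "norm (p + q) \<le> norm p + norm q"
    using norm_triangle_ineq[of "sd_fst p" "sd_fst q"] norm_triangle_ineq[of "sd_snd p" "sd_snd q"]
    by (simp add: norm_semidirect_def plus_semidirect_def)
  show "norm (r *\<^sub>R p) = \<bar>r\<bar> * norm p"
    by (simp add: norm_semidirect_def scaleR_semidirect_def distrib_left)
  show "norm (c *\<^sub>C p) = cmod c * norm p"
    by (simp add: norm_semidirect_def scaleC_semidirect_def distrib_left norm_scaleC)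
qed (auto simp: dist_semidirect_def sgn_semidirect_def uniformity_semidirect_def open_semidirect_def)

end

definition semidirect_mult ::
    "('a::complex_banach_algebra \<Rightarrow> 'u::complex_banach_algebra \<Rightarrow> 'u) \<Rightarrow> ('u \<Rightarrow> 'a \<Rightarrow> 'u) \<Rightarrow>
      ('a, 'u) semidirect \<Rightarrow> ('a, 'u) semidirect \<Rightarrow> ('a, 'u) semidirect"
  where "semidirect_mult lact ract p q =
    Semi (sd_fst p * sd_fst q)
         (lact (sd_fst p) (sd_snd q) + ract (sd_snd p) (sd_fst q) + sd_snd p * sd_snd q)"

definition derivation :: "('b::complex_vector \<Rightarrow> 'b \<Rightarrow> 'b) \<Rightarrow> ('b \<Rightarrow> 'b) \<Rightarrow> bool"
  where "derivation m D \<longleftrightarrow>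
    clinear D \<and> (\<forall>b c. D (m b c) = m b (D c) + m (D b) c)"

definition ann_alg ::
    "('a::complex_banach_algebra \<Rightarrow> 'u::complex_banach_algebra \<Rightarrow> 'u) \<Rightarrow> ('u \<Rightarrow> 'a \<Rightarrow> 'u) \<Rightarrow> 'a set"
  where "ann_alg lact ract = {a. \<forall>x. lact a x = 0 \<and> ract x a = 0}"

definition ann_self :: "'u::complex_banach_algebra set"
  where "ann_self = {x. \<forall>y. x * y = 0 \<and> y * x = 0}"

definition left_module_hom ::
    "('a::complex_banach_algebra \<Rightarrow> 'u::complex_banach_algebra \<Rightarrow> 'u) \<Rightarrow> ('a \<Rightarrow> 'u) \<Rightarrow> bool"
  where "left_module_hom lact \<phi> \<longleftrightarrow> clinear \<phi> \<and> (\<forall>a b. \<phi> (a * b) = lact a (\<phi> b))"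

definition directed_set :: "'i set \<Rightarrow> ('i \<Rightarrow> 'i \<Rightarrow> bool) \<Rightarrow> bool"
  where "directed_set I le \<longleftrightarrow>
    I \<noteq> {} \<and> (\<forall>i\<in>I. le i i) \<and>
    (\<forall>i\<in>I. \<forall>j\<in>I. \<forall>k\<in>I. le i j \<longrightarrow> le j k \<longrightarrow> le i k) \<and>
    (\<forall>i\<in>I. \<forall>j\<in>I. \<exists>k\<in>I. le i k \<and> le j k)"

definition net_converges ::
    "'i set \<Rightarrow> ('i \<Rightarrow> 'i \<Rightarrow> bool) \<Rightarrow> ('i \<Rightarrow> 'a::metric_space) \<Rightarrow> 'a \<Rightarrow> bool"
  where "net_converges I le f l \<longleftrightarrow>
    (\<forall>\<epsilon>>0. \<exists>i\<in>I. \<forall>j\<in>I. le i j \<longrightarrow> dist (f j) l < \<epsilon>)"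

definition bounded_right_approx_identity ::
    "'i set \<Rightarrow> ('i \<Rightarrow> 'i \<Rightarrow> bool) \<Rightarrow> ('i \<Rightarrow> 'a::complex_banach_algebra) \<Rightarrow> bool"
  where "bounded_right_approx_identity I le e \<longleftrightarrow>
    directed_set I le \<and> bounded (e ` I) \<and> (\<forall>a. net_converges I le (\<lambda>i. a * e i) a)"

end

theory Submission
  imports Defs
begin

text \<open>
  Evaluating the derivation on products of elements of the two summands gives the Leibniz rules
  for its components.  In the rules for the other components \<open>\<delta>\<^sub>2\<close> occurs only inside
  products \<open>\<delta>\<^sub>2(a) x\<close> and \<open>x \<delta>\<^sub>2(a)\<close> in the second algebra, which vanish because \<open>\<delta>\<^sub>2\<close> takes values in
  its annihilator.  What remains for \<open>\<delta>\<^sub>2\<close> is the rule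
  \<open>\<delta>\<^sub>2 (a b) = a \<delta>\<^sub>2(b) + \<delta>\<^sub>2(a) b\<close>, which makes \<open>D\<^sub>2\<close> a derivation, and then so is \<open>D\<^sub>1 = D - D\<^sub>2\<close>.
  The substance is the automatic continuity of \<open>\<delta>\<^sub>1\<close>, \<open>\<tau>\<^sub>1\<close> and \<open>\<tau>\<^sub>2\<close>, where
  \<open>\<tau>\<^sub>2 (a x) = a \<tau>\<^sub>2(x) + \<delta>\<^sub>1(a) x\<close> is the key rule.

  If \<open>\<tau>\<^sub>2\<close> is continuous, \<open>a\<^sub>n \<rightarrow> 0\<close> and \<open>\<delta>\<^sub>1(a\<^sub>n) \<rightarrow> b\<close>, the key rule and its mirror image yield \<open>b x = 0 = x b\<close>
  for all \<open>x\<close>; so a trivial annihilator forces \<open>b = 0\<close>, and \<open>\<delta>\<^sub>1\<close> is continuous by the closed graph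
  theorem.  The rule for \<open>\<tau>\<^sub>2 (x y)\<close> treats \<open>\<tau>\<^sub>1\<close> in the same way.  An injective left module
  homomorphism \<open>\<phi>\<close> on an algebra with a right approximate identity makes the annihilator trivial:
  \<open>\<phi> (b a) = b \<phi>(a) = 0\<close> gives \<open>b a = 0\<close> for all \<open>a\<close>, and \<open>a\<close> may run through the approximate identity.

  For a surjective \<open>\<phi>\<close> the tool is Cohen's factorization theorem, in the form that a null sequence
  can be written as \<open>b\<^sub>k c\<close> with \<open>b\<^sub>k\<close> bounded and a single right factor \<open>c\<close>.  It shows that a linear map
  \<open>\<psi>\<close> is bounded as soon as all maps \<open>a \<mapsto> \<psi> (a c)\<close> are bounded
  (\<open>bounded_linear_if_bounded_on_right_multiples\<close>).  This applies to \<open>\<phi>\<close>, since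
  \<open>\<phi> (a c) = a \<phi>(c)\<close>, and to \<open>\<tau>\<^sub>2 \<circ> \<phi>\<close>, since \<open>\<tau>\<^sub>2 (\<phi> (a c)) = a \<tau>\<^sub>2(\<phi>(c)) + \<delta>\<^sub>1(a) \<phi>(c)\<close>.  By the open
  mapping theorem \<open>\<tau>\<^sub>2\<close> is then bounded as well.
\<close>

section \<open>The open mapping and closed graph theorems\<close>

lemma convergent_if_summable_increments:
  fixes a :: "nat \<Rightarrow> 'a::banach"
  assumes d: "summable d" and inc: "\<And>n. norm (a (Suc n) - a n) \<le> d n"
  obtains l where "a \<longlonglongrightarrow> l" "norm (l - a 0) \<le> suminf d"
proof -
  let ?i = "\<lambda>n. a (Suc n) - a n"
  have sn: "summable (\<lambda>n. norm (?i n))"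
    by (rule summable_comparison_test'[OF d, of 0]) (use inc in auto)
  have "(\<lambda>n. \<Sum>k<n. ?i k) \<longlonglongrightarrow> suminf ?i"
    by (rule summable_LIMSEQ[OF summable_norm_cancel[OF sn]])
  then have "(\<lambda>n. (a n - a 0) + a 0) \<longlonglongrightarrow> suminf ?i + a 0"
    by (intro tendsto_intros) (simp add: sum_lessThan_telescope)
  moreover have "norm (suminf ?i) \<le> suminf d"
    using summable_norm[OF sn] suminf_le[OF inc sn d] by linarith
  ultimately show thesis
    using that[of "suminf ?i + a 0"] by simp
qed

text \<open>
  The successive approximation half of the open mapping theorem: the error left by an approximate
  preimage is corrected by an approximate preimage of the error, and since the errors are halved
  each time, the corrections add up to at most twice the first bound.
\<close>

lemma exact_preimage_from_approximate_preimages: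
  fixes T :: "'a::banach \<Rightarrow> 'b::banach"
  assumes T: "bounded_linear T" and S: "closed S" "subspace S"
    and K: "K \<ge> 0"
    and approx: "\<And>y \<epsilon>. \<epsilon> > 0 \<Longrightarrow> \<exists>x\<in>S. norm x \<le> K * norm y \<and> norm (y - T x) < \<epsilon>"
  shows "\<exists>x\<in>S. T x = y \<and> norm x \<le> 2 * K * norm y"
proof -
  interpret T: bounded_linear T by fact
  \<comment> \<open>The bound is not strict because for \<open>y = 0\<close> an error below \<open>norm y / 2\<close> is impossible.\<close>
  have "\<exists>x\<in>S. norm x \<le> K * norm y \<and> norm (y - T x) \<le> norm y / 2" for y
  proof (cases "y = 0")
    case True
    then show ?thesis
      using subspace_0[OF S(2)] by (intro bexI[of _ 0]) (auto simp: T.zero)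
  next
    case False
    then show ?thesis
      using approx[of "norm y / 2" y] by (auto intro: less_imp_le)
  qed
  then obtain g where g: "\<And>y. g y \<in> S" "\<And>y. norm (g y) \<le> K * norm y"
      "\<And>y. norm (y - T (g y)) \<le> norm y / 2"
    by metis
  define r where "r = rec_nat y (\<lambda>_ v. v - T (g v))"
  have r0: "r 0 = y" and rS: "\<And>n. r (Suc n) = r n - T (g (r n))"
    by (simp_all add: r_def)
  have rb: "norm (r n) \<le> norm y * (1/2)^n" for n
  proof (induction n)
    case (Suc n)
    then show ?case using g(3)[of "r n"] by (simp add: rS)
  qed (simp add: r0)
  define s where "s n = (\<Sum>k<n. g (r k))" for n
  have Ts: "T (s n) = y - r n" for n
    by (induction n) (auto simp: s_def r0 rS T.zero T.add)
  have sS: "s n \<in> S" for n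
    unfolding s_def by (intro subspace_sum S g)
  have geo: "(\<lambda>n. (K * norm y) * (1/2::real)^n) sums (K * norm y * 2)"
    using sums_mult[OF geometric_sums[of "1/2::real"], of "K * norm y"] by simp
  have inc: "norm (s (Suc n) - s n) \<le> (K * norm y) * (1/2)^n" for n
    using order_trans[OF g(2)[of "r n"] mult_left_mono[OF rb[of n] K]]
    by (simp add: s_def mult.assoc)
  obtain x where x: "s \<longlonglongrightarrow> x" and nx: "norm (x - s 0) \<le> suminf (\<lambda>n. (K * norm y) * (1/2)^n)"
    using convergent_if_summable_increments[OF sums_summable[OF geo], of s] inc by blast
  have "x \<in> S"
    using S(1) sS x closed_sequentially by blast
  moreover have "norm x \<le> 2 * K * norm y"
    using nx sums_unique[OF geo] by (simp add: s_def mult.commute mult.left_commute)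
  moreover have "T x = y"
  proof -
    have "(\<lambda>n. norm y * (1/2::real)^n) \<longlonglongrightarrow> norm y * 0"
      by (intro tendsto_mult_left LIMSEQ_realpow_zero) auto
    then have "r \<longlonglongrightarrow> 0"
      by (intro Lim_null_comparison[of r]) (use rb in auto)
    then have "(\<lambda>n. T (s n)) \<longlonglongrightarrow> y - 0"
      unfolding Ts by (intro tendsto_intros)
    moreover have "(\<lambda>n. T (s n)) \<longlonglongrightarrow> T x"
      by (rule T.tendsto[OF x])
    ultimately show ?thesis
      using LIMSEQ_unique by force
  qed
  ultimately show ?thesis by blast
qed

text \<open>
  By the Baire category theorem the image of some ball of \<open>S\<close> is dense in a ball of the codomain,
  which provides the approximate preimages for the previous lemma.  The domain is a closed subspace
  and not a whole type so that the closed graph theorem follows by projecting the graph.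
\<close>

theorem open_mapping_on_closed_subspace:
  fixes T :: "'a::banach \<Rightarrow> 'b::banach"
  assumes T: "bounded_linear T" and S: "closed S" "subspace S" and onto: "T ` S = UNIV"
  obtains C where "C \<ge> 0" "\<And>y. \<exists>x\<in>S. T x = y \<and> norm x \<le> C * norm y"
proof -
  interpret T: bounded_linear T by fact
  define W where "W n = T ` (S \<inter> cball 0 (real n))" for n
  have "(\<Union>n. closure (W n)) = UNIV"
  proof -
    have "y \<in> (\<Union>n. closure (W n))" for y
    proof -
      have "y \<in> T ` S" by (simp add: onto)
      then obtain x where "x \<in> S" "T x = y" by blast
      moreover obtain n where "norm x \<le> real n" using real_arch_simple by blast
      ultimately have "y \<in> W n" by (auto simp: W_def)
      then show ?thesis using closure_subset by blast
    qed
    then show ?thesis by blast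
  qed
  then have "\<exists>n. interior (closure (W n)) \<noteq> {}"
    using Met_TC.metric_Baire_category_alt[of "range (\<lambda>n. closure (W n))"]
    by (auto simp: complete_UNIV)
  then obtain n y0 where "y0 \<in> interior (closure (W n))" by blast
  then obtain r where r: "r > 0" "ball y0 r \<subseteq> closure (W n)"
    by (meson mem_interior)
  \<comment> \<open>To move the centre of the ball from \<open>y0\<close> to \<open>0\<close>, \<open>v\<close> is written as half the difference of
    \<open>y0 + v\<close> and \<open>y0 - v\<close>; half the difference of approximate preimages of these is one of \<open>v\<close>.\<close>
  have near: "\<exists>x\<in>S. norm x \<le> n \<and> norm (v - T x) < \<epsilon>" if "norm v < r" "\<epsilon> > 0" for v \<epsilon>
  proof -
    have "y0 + v \<in> closure (W n)" "y0 - v \<in> closure (W n)"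
      using that r(2) by (auto simp: dist_norm subset_iff)
    then obtain w1 w2 where w: "w1 \<in> W n" "dist w1 (y0 + v) < \<epsilon>" "w2 \<in> W n" "dist w2 (y0 - v) < \<epsilon>"
      using \<open>\<epsilon> > 0\<close> unfolding closure_approachable by blast
    then obtain x1 x2 where x: "x1 \<in> S" "norm x1 \<le> n" "w1 = T x1" "x2 \<in> S" "norm x2 \<le> n" "w2 = T x2"
      by (auto simp: W_def)
    let ?x = "(1/2) *\<^sub>R (x1 - x2)"
    have "norm ?x \<le> n"
      using x norm_triangle_ineq4[of x1 x2] by simp
    moreover have "?x \<in> S"
      by (intro subspace_mul subspace_diff S x)
    moreover have "norm (v - T ?x) < \<epsilon>"
    proof -
      have "v - T ?x = (1/2) *\<^sub>R (((y0 + v) - w1) - ((y0 - v) - w2))"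
        by (simp add: T.scaleR T.diff x algebra_simps flip: scaleR_add_left)
      then have "norm (v - T ?x) = (1/2) * norm (((y0 + v) - w1) - ((y0 - v) - w2))"
        by simp
      also have "\<dots> \<le> (1/2) * (norm ((y0 + v) - w1) + norm ((y0 - v) - w2))"
        by (intro mult_left_mono norm_triangle_ineq4) auto
      also have "\<dots> < \<epsilon>"
        using w by (simp add: dist_norm norm_minus_commute)
      finally show ?thesis .
    qed
    ultimately show ?thesis by blast
  qed
  define K where "K = 2 * real n / r"
  have K: "K \<ge> 0" using r by (simp add: K_def)
  have approx: "\<exists>x\<in>S. norm x \<le> K * norm y \<and> norm (y - T x) < \<epsilon>" if "\<epsilon> > 0" for y \<epsilon>
  proof (cases "y = 0")
    case True
    then show ?thesis
      using subspace_0[OF S(2)] that by (intro bexI[of _ 0]) (auto simp: T.zero)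
  next
    case False
    define t where "t = r / (2 * norm y)"
    have t: "t > 0" using False r by (simp add: t_def)
    have "norm (t *\<^sub>R y) < r" using False r by (simp add: t_def)
    then obtain x where x: "x \<in> S" "norm x \<le> n" "norm (t *\<^sub>R y - T x) < t * \<epsilon>"
      using near[of "t *\<^sub>R y", OF _ mult_pos_pos[OF t \<open>\<epsilon> > 0\<close>]] by blast
    let ?x = "inverse t *\<^sub>R x"
    have "norm ?x \<le> K * norm y"
      using x(2) t r False by (simp add: t_def K_def field_simps)
    moreover have "norm (y - T ?x) < \<epsilon>"
    proof -
      have "y - T ?x = inverse t *\<^sub>R (t *\<^sub>R y - T x)"
        using t by (simp add: T.scaleR scaleR_diff_right)
      then have "norm (y - T ?x) = inverse t * norm (t *\<^sub>R y - T x)"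
        using t by (simp only: norm_scaleR abs_of_pos positive_imp_inverse_positive)
      also have "\<dots> < inverse t * (t * \<epsilon>)"
        using x(3) t by (intro mult_strict_left_mono) auto
      also have "\<dots> = \<epsilon>" using t by simp
      finally show ?thesis .
    qed
    ultimately show ?thesis using subspace_mul[OF S(2) x(1)] by blast
  qed
  show thesis
    using that[of "2 * K"] K exact_preimage_from_approximate_preimages[OF T S K approx] by simp
qed

text \<open>
  By linearity the graph is closed if its closure contains no point \<open>(0, y)\<close> with \<open>y \<noteq> 0\<close>; then
  the first projection maps the graph, a Banach space, onto the domain, and the bounded choice of
  preimages under this projection is the bound for \<open>f\<close>.
\<close>

corollary closed_graph:
  fixes f :: "'a::banach \<Rightarrow> 'b::banach"
  assumes f: "linear f"
    and sep: "\<And>X y. X \<longlonglongrightarrow> 0 \<Longrightarrow> (\<lambda>n. f (X n)) \<longlonglongrightarrow> y \<Longrightarrow> y = 0"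
  shows "bounded_linear f"
proof -
  interpret f: linear f by fact
  let ?G = "range (\<lambda>a. (a, f a))"
  have sub: "subspace ?G"
    by (auto simp: subspace_def image_iff f.add f.scale zero_prod_def f.zero)
  have clo: "closed ?G"
    unfolding closed_sequential_limits
  proof (intro allI impI, elim conjE)
    fix P p assume P: "\<forall>n. P n \<in> ?G" "P \<longlonglongrightarrow> p"
    define X where "X n = fst (P n)" for n
    have PX: "P n = (X n, f (X n))" for n
      using P(1)[rule_format, of n] by (auto simp: X_def)
    have lim: "X \<longlonglongrightarrow> fst p" "(\<lambda>n. f (X n)) \<longlonglongrightarrow> snd p"
      using tendsto_fst[OF P(2)] tendsto_snd[OF P(2)] by (simp_all add: PX)
    have "snd p - f (fst p) = 0"
    proof (rule sep)
      show "(\<lambda>n. X n - fst p) \<longlonglongrightarrow> 0"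
        using lim(1) LIM_zero by blast
      show "(\<lambda>n. f (X n - fst p)) \<longlonglongrightarrow> snd p - f (fst p)"
        unfolding f.diff by (intro tendsto_intros lim)
    qed
    then show "p \<in> ?G" by (metis eq_iff_diff_eq_0 prod.collapse rangeI)
  qed
  have onto: "fst ` ?G = (UNIV :: 'a set)"
    by (simp add: image_image)
  obtain C where C: "\<And>a. \<exists>p\<in>?G. fst p = a \<and> norm p \<le> C * norm a"
    by (rule open_mapping_on_closed_subspace[OF bounded_linear_fst clo sub onto]) blast
  have "norm (f a) \<le> norm a * C" for a
  proof -
    have "norm (a, f a) \<le> C * norm a" using C[of a] by auto
    then show ?thesis using norm_snd_le[of "f a" a] by (simp add: mult.commute)
  qed
  then show ?thesis
    by (intro bounded_linear.intro[OF f] bounded_linear_axioms.intro exI[of _ C]) simp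
qed

lemma bounded_linear_if_continuous:
  fixes f :: "'a::banach \<Rightarrow> 'b::banach"
  assumes f: "linear f" and cont: "continuous_on UNIV f"
  shows "bounded_linear f"
proof (rule closed_graph[OF f])
  fix X y assume X: "X \<longlonglongrightarrow> 0" "(\<lambda>n. f (X n)) \<longlonglongrightarrow> y"
  have "isCont f 0"
    using cont continuous_on_eq_continuous_at[OF open_UNIV, of f] by blast
  then have "(\<lambda>n. f (X n)) \<longlonglongrightarrow> f 0"
    using X(1) by (rule isCont_tendsto_compose)
  then have "y = f 0"
    by (rule LIMSEQ_unique[OF X(2)])
  then show "y = 0"
    by (simp add: linear_0[OF f])
qed

lemma bounded_linear_if_composite_with_surjection:
  fixes \<phi> :: "'a::banach \<Rightarrow> 'b::banach" and f :: "'b \<Rightarrow> 'c::real_normed_vector"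
  assumes \<phi>: "bounded_linear \<phi>" "surj \<phi>" and f: "linear f" and comp: "bounded_linear (\<lambda>a. f (\<phi> a))"
  shows "bounded_linear f"
proof -
  obtain C where C: "\<And>y. \<exists>x\<in>UNIV. \<phi> x = y \<and> norm x \<le> C * norm y"
    by (rule open_mapping_on_closed_subspace[OF \<phi>(1) closed_UNIV subspace_UNIV \<phi>(2)]) blast
  obtain B where B: "B \<ge> 0" "\<And>a. norm (f (\<phi> a)) \<le> norm a * B"
    using bounded_linear.nonneg_bounded[OF comp] by blast
  have "norm (f y) \<le> norm y * (C * B)" for y
  proof -
    obtain x where x: "\<phi> x = y" "norm x \<le> C * norm y" using C[of y] by blast
    have "norm (f y) \<le> norm x * B" using B(2)[of x] x(1) by simp
    also have "\<dots> \<le> (C * norm y) * B" by (intro mult_right_mono x B)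
    finally show ?thesis by (simp add: mult_ac)
  qed
  then show ?thesis
    by (intro bounded_linear.intro[OF f] bounded_linear_axioms.intro exI[of _ "C * B"]) simp
qed

section \<open>Factorization of null sequences\<close>

text \<open>
  The content of a right approximate identity bounded by \<open>M\<close>, without an index set: finitely many
  elements can be approximated at once.  The type argument makes the algebra a parameter of the
  predicate, as the bound alone does not mention it.
\<close>

definition approximates_right_identity :: "real \<Rightarrow> 'a::real_normed_algebra itself \<Rightarrow> bool"
  where "approximates_right_identity M _ \<longleftrightarrow>
    (\<forall>(F :: 'a set) \<epsilon>. finite F \<longrightarrow> 0 < \<epsilon> \<longrightarrow>
      (\<exists>e. norm e \<le> M \<and> (\<forall>a\<in>F. norm (a - a * e) < \<epsilon>)))"

lemma approximates_right_identity_if_net: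
  fixes e :: "'i \<Rightarrow> 'a::complex_banach_algebra"
  assumes "bounded_right_approx_identity I le e"
  obtains M where "approximates_right_identity M TYPE('a)"
proof -
  have dir: "directed_set I le" and bd: "bounded (e ` I)"
    and lim: "net_converges I le (\<lambda>i. a * e i) a" for a
    using assms by (simp_all add: bounded_right_approx_identity_def)
  note dir' = dir[unfolded directed_set_def]
  have ne: "I \<noteq> {}" using dir' by (rule conjunct1)
  have refl: "\<forall>i\<in>I. le i i"
    using dir'[THEN conjunct2] by (rule conjunct1)
  have trans: "\<forall>i\<in>I. \<forall>j\<in>I. \<forall>k\<in>I. le i j \<longrightarrow> le j k \<longrightarrow> le i k"
    using dir'[THEN conjunct2, THEN conjunct2] by (rule conjunct1)
  have ub: "\<forall>i\<in>I. \<forall>j\<in>I. \<exists>k\<in>I. le i k \<and> le j k"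
    using dir'[THEN conjunct2, THEN conjunct2] by (rule conjunct2)
  have conv: "\<exists>i\<in>I. \<forall>j\<in>I. le i j \<longrightarrow> norm (a - a * e j) < \<epsilon>" if "\<epsilon> > 0" for a \<epsilon>
    using lim[of a] that by (simp add: net_converges_def dist_norm norm_minus_commute)
  obtain M where M: "M > 0" "\<And>i. i \<in> I \<Longrightarrow> norm (e i) \<le> M"
    using bd unfolding bounded_pos by auto
  have ev: "\<exists>i\<in>I. \<forall>j\<in>I. le i j \<longrightarrow> (\<forall>a\<in>F. norm (a - a * e j) < \<epsilon>)"
    if "finite F" "\<epsilon> > 0" for F \<epsilon>
    using that(1)
  proof (induction F)
    case empty
    then show ?case using ne by blast
  next
    case (insert a F)
    obtain i where i: "i \<in> I" "\<forall>j\<in>I. le i j \<longrightarrow> (\<forall>a\<in>F. norm (a - a * e j) < \<epsilon>)"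
      using insert.IH by blast
    obtain i' where i': "i' \<in> I" "\<forall>j\<in>I. le i' j \<longrightarrow> norm (a - a * e j) < \<epsilon>"
      using conv[OF \<open>\<epsilon> > 0\<close>] by blast
    obtain k where k: "k \<in> I" "le i k" "le i' k"
      using ub i(1) i'(1) by blast
    show ?case
    proof (intro bexI[OF _ k(1)] ballI impI)
      fix j b assume j: "j \<in> I" "le k j" and b: "b \<in> insert a F"
      have "le i j" "le i' j"
        using trans[rule_format, OF i(1) k(1) j(1)] trans[rule_format, OF i'(1) k(1) j(1)] k j by blast+
      then show "norm (b - b * e j) < \<epsilon>"
        using i(2) i'(2) j(1) b by blast
    qed
  qed
  have "\<exists>e. norm e \<le> M \<and> (\<forall>a\<in>F. norm (a - a * e) < \<epsilon>)"
    if "finite F" "\<epsilon> > 0" for F :: "'a set" and \<epsilon>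
  proof -
    obtain i where "i \<in> I" "\<forall>j\<in>I. le i j \<longrightarrow> (\<forall>a\<in>F. norm (a - a * e j) < \<epsilon>)"
      using ev[OF \<open>finite F\<close> \<open>\<epsilon> > 0\<close>] by blast
    then show ?thesis
      using M(2) refl by blast
  qed
  then show thesis
    using that[of M] by (auto simp: approximates_right_identity_def)
qed

lemma approximates_right_identity_bound_nonneg:
  assumes "approximates_right_identity M TYPE('a::real_normed_algebra)"
  shows "M \<ge> 0"
proof -
  obtain e :: 'a where "norm e \<le> M"
    using assms[unfolded approximates_right_identity_def, rule_format, of "{}" 1] by auto
  then show ?thesis
    using norm_ge_zero[of e] by linarith
qed

lemma right_annihilated_only_zero:
  fixes a :: "'a::real_normed_algebra"
  assumes "approximates_right_identity M TYPE('a)" and "\<And>b. a * b = 0"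
  shows "a = 0"
proof (rule ccontr)
  assume "a \<noteq> 0"
  then obtain e where "norm (a - a * e) < norm a"
    using assms(1) unfolding approximates_right_identity_def
    by (metis finite.emptyI finite.insertI insertI1 zero_less_norm_iff)
  then show False using assms(2) by simp
qed

text \<open>
  One \<open>e\<close> serves all members of a null sequence: finitely many are handled by the approximate
  identity, and on the others the bound on \<open>e\<close> keeps the error small.
\<close>

lemma approximates_null_sequence:
  fixes z :: "nat \<Rightarrow> 'a::real_normed_algebra"
  assumes ai: "approximates_right_identity M TYPE('a)" and z: "z \<longlonglongrightarrow> 0"
    and \<epsilon>: "\<epsilon> > 0" and \<eta>: "\<eta> > 0"
  obtains e where "norm e \<le> M" "\<And>k. norm (z k - z k * e) < \<epsilon>" "norm (c - c * e) < \<eta>"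
proof -
  have M: "M \<ge> 0" by (rule approximates_right_identity_bound_nonneg[OF ai])
  obtain K where K: "\<And>k. k \<ge> K \<Longrightarrow> norm (z k) < \<epsilon> / (1 + M)"
    using LIMSEQ_D[OF z, of "\<epsilon> / (1 + M)"] \<epsilon> M by auto
  obtain e where e: "norm e \<le> M" "\<forall>a\<in>insert c (z ` {..<K}). norm (a - a * e) < min \<epsilon> \<eta>"
    using ai[unfolded approximates_right_identity_def, rule_format,
        of "insert c (z ` {..<K})" "min \<epsilon> \<eta>"] \<epsilon> \<eta> by auto
  have "norm (z k - z k * e) < \<epsilon>" for k
  proof (cases "k < K")
    case False
    have "norm (z k - z k * e) \<le> norm (z k) + norm (z k) * norm e"
      using norm_triangle_ineq4[of "z k" "z k * e"] norm_mult_ineq[of "z k" e] by linarith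
    also have "\<dots> \<le> norm (z k) * (1 + M)"
      using e(1) by (simp add: distrib_left mult_left_mono)
    also have "\<dots> < \<epsilon>"
      using K[of k] False M by (simp add: field_simps)
    finally show ?thesis .
  qed (use e in auto)
  then show thesis using that[of e] e by auto
qed

text \<open>
  Right multiplication by \<open>(1 - l) + l e\<close>, an element of the unitization, is a perturbation of the
  identity by an operator of norm at most \<open>1/2\<close>, hence invertible with an inverse \<open>S\<close> of norm at most
  \<open>2\<close>.  Stating this for the action on the algebra itself avoids the unitization.  The last conclusion says that \<open>S\<close> barely moves the points that \<open>e\<close> barely moves.
\<close>

lemma inverse_of_averaged_right_multiplication:
  fixes e :: "'a::{real_normed_algebra,banach}"
  assumes l: "l > 0" "l * (1 + norm e) \<le> 1 / 2"
  obtains S where "\<And>x. S x - l *\<^sub>R (S x - S x * e) = x"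
    "\<And>x y. norm (S x - S y) \<le> 2 * norm (x - y)"
    "\<And>x. norm (S x - x) \<le> norm (x - x * e)"
proof -
  define N where "N x = l *\<^sub>R (x - x * e)" for x
  have Ndiff: "N x - N y = N (x - y)" for x y
    by (simp add: N_def algebra_simps)
  have Nb: "norm (N x) \<le> norm x / 2" for x
  proof -
    have "norm (x - x * e) \<le> norm x * (1 + norm e)"
      using norm_triangle_ineq4[of x "x * e"] norm_mult_ineq[of x e] by (simp add: distrib_left)
    then have "norm (N x) \<le> l * (norm x * (1 + norm e))"
      using l(1) by (simp add: N_def)
    also have "\<dots> = norm x * (l * (1 + norm e))" by simp
    also have "\<dots> \<le> norm x * (1/2)" by (intro mult_left_mono l) auto
    finally show ?thesis by simp
  qed
  have "\<exists>!w. x + N w = w" for x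
  proof (rule banach_fix_type[of "1/2"])
    show "\<forall>u v. dist (x + N u) (x + N v) \<le> 1/2 * dist u v"
      using Nb by (simp add: dist_norm Ndiff)
  qed auto
  then obtain S where S: "\<And>x. x + N (S x) = S x" by metis
  have eq: "S x - N (S x) = x" for x
    using S[of x] by (metis add_diff_cancel_right')
  have lip: "norm w \<le> 2 * norm (w - N w)" for w
    using Nb[of w] norm_triangle_ineq2[of w "N w"] by linarith
  have "norm (S x - S y) \<le> 2 * norm (x - y)" for x y
  proof -
    have "(S x - S y) - N (S x - S y) = (S x - N (S x)) - (S y - N (S y))"
      by (simp flip: Ndiff)
    then show ?thesis using lip[of "S x - S y"] by (simp add: eq)
  qed
  moreover have "norm (S x - x) \<le> norm (x - x * e)" for x
  proof -
    have "(S x - x) - N (S x - x) = N x"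
      using S[of x] by (simp add: Ndiff[symmetric] algebra_simps)
    then have "norm (S x - x) \<le> 2 * (l * norm (x - x * e))"
      using lip[of "S x - x"] l(1) by (simp add: N_def)
    also have "\<dots> \<le> 1 * norm (x - x * e)"
    proof -
      have "l * 1 \<le> l * (1 + norm e)" using l(1) by (intro mult_left_mono) auto
      then have "2 * l \<le> 1" using l(2) by linarith
      then show ?thesis using mult_right_mono[of "2 * l" 1 "norm (x - x * e)"] by simp
    qed
    finally show ?thesis by simp
  qed
  ultimately show thesis
    using that[of S] eq by (simp add: N_def)
qed

text \<open>
  Cohen's construction.  Let \<open>c\<^sub>n\<close> be the product of the elements \<open>(1 - l) + l e\<^sub>i\<close> of the unitization for
  \<open>i < n\<close>.  Its scalar part is \<open>\<mu> n = (1 - l)\<^sup>n\<close>, which tends to \<open>0\<close>; its part in the algebra is called \<open>\<alpha> n\<close>.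
  The product is invertible, and \<open>S n\<close> is right multiplication by the inverse, so that
  \<open>x = \<mu> n (S n x) + (S n x) (\<alpha> n)\<close>.  If each \<open>e\<^sub>n\<close> is chosen well enough after its predecessors,
  \<open>\<alpha> n\<close> converges to some \<open>c\<close> and \<open>S n (z k)\<close> to some \<open>b k\<close>, uniformly in \<open>k\<close>, although the norms
  of the inverses may grow like \<open>2\<^sup>n\<close>.  In the limit the scalar part disappears and \<open>z k = b k c\<close>.
\<close>

theorem Cohen_factorization_null_sequence:
  fixes z :: "nat \<Rightarrow> 'a::{real_normed_algebra,banach}"
  assumes ai: "approximates_right_identity M TYPE('a)" and z: "z \<longlonglongrightarrow> 0"
  obtains b c B where "\<And>k. z k = b k * c" "\<And>k. norm (b k) \<le> B"
proof -
  have M: "M \<ge> 0" by (rule approximates_right_identity_bound_nonneg[OF ai])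
  define l where "l = 1 / (2 * (1 + M))"
  have l: "0 < l" "l < 1" "l * (1 + M) = 1/2"
    using M by (auto simp: l_def field_simps)
  define \<mu> where "\<mu> n = (1 - l) ^ n" for n
  have \<mu>: "\<mu> n \<ge> 0" for n using l by (simp add: \<mu>_def)
  \<comment> \<open>A state \<open>f\<close> is the pair \<open>(\<alpha> n, S n)\<close>; \<open>P\<close> is the invariant and \<open>Q\<close> bounds the change in one step.\<close>
  define P where "P n f \<longleftrightarrow> (case f of (\<alpha>, S) \<Rightarrow>
      (\<forall>x::'a. \<mu> n *\<^sub>R S x + S x * \<alpha> = x) \<and> (\<forall>x y::'a. norm (S x - S y) \<le> 2 ^ n * norm (x - y)))"
    for n and f :: "'a \<times> ('a \<Rightarrow> 'a)"
  define Q where "Q n f f' \<longleftrightarrow>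
      norm (fst f' - fst f) \<le> (1/2) ^ n + M * \<mu> n \<and> (\<forall>k. norm (snd f' (z k) - snd f (z k)) \<le> (1/2) ^ n)"
    for n and f f' :: "'a \<times> ('a \<Rightarrow> 'a)"
  have step: "\<exists>f'. P (Suc n) f' \<and> Q n f f'" if "P n f" for n f
  proof -
    obtain \<alpha> S where f: "f = (\<alpha>, S)" by (cases f)
    have inv: "\<And>x. \<mu> n *\<^sub>R S x + S x * \<alpha> = x" and lip: "\<And>x y. norm (S x - S y) \<le> 2 ^ n * norm (x - y)"
      using that by (auto simp: P_def f)
    \<comment> \<open>Since \<open>S\<close> may stretch by \<open>2 ^ n\<close>, the error \<open>(1/4) ^ n\<close> is what leaves \<open>(1/2) ^ n\<close>.\<close>
    obtain e where e: "norm e \<le> M" "\<And>k. norm (z k - z k * e) < (1/4) ^ n"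
        "norm (\<alpha> - \<alpha> * e) < (1/2) ^ n"
      using approximates_null_sequence[OF ai z, of "(1/4)^n" "(1/2)^n" \<alpha>] by auto
    have "l * (1 + norm e) \<le> l * (1 + M)"
      using e(1) l(1) by (intro mult_left_mono) auto
    then have "l * (1 + norm e) \<le> 1/2"
      using l(3) by simp
    then obtain T where T: "\<And>x. T x - l *\<^sub>R (T x - T x * e) = x"
      "\<And>x y. norm (T x - T y) \<le> 2 * norm (x - y)"
      "\<And>x. norm (T x - x) \<le> norm (x - x * e)"
      using inverse_of_averaged_right_multiplication[OF l(1)] by metis
    let ?S = "\<lambda>x. S (T x)"
    let ?\<alpha> = "\<alpha> - l *\<^sub>R (\<alpha> - \<alpha> * e) + (l * \<mu> n) *\<^sub>R e"
    have "\<mu> (Suc n) *\<^sub>R ?S x + ?S x * ?\<alpha> = x" for x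
    proof -
      \<comment> \<open>Multiplying by \<open>c\<^sub>n\<^sub>+\<^sub>1\<close> means multiplying by \<open>c\<^sub>n\<close>, with result \<open>?w\<close>, and then by the new factor.\<close>
      let ?w = "\<mu> n *\<^sub>R ?S x + ?S x * \<alpha>"
      have "\<mu> (Suc n) *\<^sub>R ?S x + ?S x * ?\<alpha> = ?w - l *\<^sub>R (?w - ?w * e)"
        by (simp add: \<mu>_def algebra_simps)
      then show ?thesis by (simp only: inv T(1))
    qed
    moreover have "norm (?S x - ?S y) \<le> 2 ^ Suc n * norm (x - y)" for x y
      using order_trans[OF lip[of "T x" "T y"] mult_left_mono[OF T(2)[of x y], of "2 ^ n"]]
      by (simp add: mult.left_commute)
    ultimately have "P (Suc n) (?\<alpha>, ?S)" by (simp add: P_def)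
    moreover have "norm (?S (z k) - S (z k)) \<le> (1/2) ^ n" for k
    proof -
      have "norm (?S (z k) - S (z k)) \<le> 2 ^ n * norm (z k - z k * e)"
        using order_trans[OF lip[of "T (z k)" "z k"] mult_left_mono[OF T(3)[of "z k"], of "2 ^ n"]]
        by simp
      also have "\<dots> \<le> 2 ^ n * (1/4) ^ n"
        using e(2)[of k] by (intro mult_left_mono) auto
      also have "\<dots> = (1/2) ^ n"
        by (simp flip: power_mult_distrib)
      finally show ?thesis .
    qed
    moreover have "norm (?\<alpha> - \<alpha>) \<le> (1/2) ^ n + M * \<mu> n"
    proof -
      have "norm (?\<alpha> - \<alpha>) \<le> norm ((l * \<mu> n) *\<^sub>R e) + norm (l *\<^sub>R (\<alpha> - \<alpha> * e))"
        using norm_triangle_ineq4[of "(l * \<mu> n) *\<^sub>R e" "l *\<^sub>R (\<alpha> - \<alpha> * e)"] by (simp add: algebra_simps)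
      also have "\<dots> = l * (\<mu> n * norm e) + l * norm (\<alpha> - \<alpha> * e)"
        using l \<mu>[of n] by simp
      also have "\<dots> \<le> 1 * (\<mu> n * M) + 1 * (1/2) ^ n"
        using l \<mu>[of n] e by (intro add_mono mult_mono) auto
      finally show ?thesis by (simp add: mult.commute)
    qed
    ultimately have "P (Suc n) (?\<alpha>, ?S) \<and> Q n f (?\<alpha>, ?S)"
      unfolding Q_def f fst_conv snd_conv by blast
    then show ?thesis by blast
  qed
  have "P 0 (0, \<lambda>x. x)" by (simp add: P_def \<mu>_def)
  then obtain f where f0: "f 0 = (0, \<lambda>x. x)" and f: "\<And>n. P n (f n)" "\<And>n. Q n (f n) (f (Suc n))"
    using dependent_nat_choice[of "\<lambda>n f. P n f \<and> (n = 0 \<longrightarrow> f = (0, \<lambda>x. x))" Q] step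
    by (metis nat.distinct(1))
  define \<alpha> where "\<alpha> n = fst (f n)" for n
  define S where "S n = snd (f n)" for n
  have inv: "\<mu> n *\<^sub>R S n x + S n x * \<alpha> n = x" for n x
    using f(1)[of n] by (auto simp: P_def \<alpha>_def S_def split: prod.splits)
  have inc: "norm (\<alpha> (Suc n) - \<alpha> n) \<le> (1/2) ^ n + M * \<mu> n"
     "norm (S (Suc n) (z k) - S n (z k)) \<le> (1/2) ^ n" for n k
    using f(2)[of n] by (auto simp: Q_def \<alpha>_def S_def)
  have sum: "summable (\<lambda>n. (1/2) ^ n + M * \<mu> n)"
    unfolding \<mu>_def using l by (intro summable_add summable_mult summable_geometric) auto
  obtain c where c: "\<alpha> \<longlonglongrightarrow> c"
    by (rule convergent_if_summable_increments[OF sum inc(1)])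
  have "\<exists>b. (\<lambda>n. S n (z k)) \<longlonglongrightarrow> b \<and> norm (b - z k) \<le> 2" for k
  proof -
    have geo: "(\<lambda>n. (1/2::real) ^ n) sums 2"
      using geometric_sums[of "1/2::real"] by simp
    obtain b where "(\<lambda>n. S n (z k)) \<longlonglongrightarrow> b" "norm (b - S 0 (z k)) \<le> (\<Sum>n. (1/2) ^ n)"
      by (rule convergent_if_summable_increments[OF sums_summable[OF geo] inc(2)])
    moreover have "S 0 (z k) = z k"
      by (simp add: S_def f0)
    ultimately show ?thesis
      using sums_unique[OF geo] by auto
  qed
  then obtain b where b: "\<And>k. (\<lambda>n. S n (z k)) \<longlonglongrightarrow> b k" "\<And>k. norm (b k - z k) \<le> 2"
    by metis
  have "z k = b k * c" for k
  proof -
    have "\<mu> \<longlonglongrightarrow> 0" unfolding \<mu>_def using l by (intro LIMSEQ_realpow_zero) auto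
    then have "(\<lambda>n. \<mu> n *\<^sub>R S n (z k) + S n (z k) * \<alpha> n) \<longlonglongrightarrow> 0 *\<^sub>R b k + b k * c"
      by (intro tendsto_intros b c)
    then show ?thesis by (simp add: inv LIMSEQ_const_iff)
  qed
  moreover obtain B where "\<And>k. norm (z k) \<le> B"
    using convergent_imp_Bseq[of z] z by (auto simp: convergent_def Bseq_def)
  then have "norm (b k) \<le> B + 2" for k
    using b(2)[of k] norm_triangle_sub[of "b k" "z k"] by (smt (verit))
  ultimately show thesis using that by blast
qed

text \<open>
  An unbounded \<open>\<psi>\<close> is unbounded on some null sequence \<open>z\<close>.  Writing \<open>z n = b n * c\<close> with bounded \<open>b\<close>
  contradicts the boundedness of \<open>a \<mapsto> \<psi> (a * c)\<close>.
\<close>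

theorem bounded_linear_if_bounded_on_right_multiples:
  fixes \<psi> :: "'a::{real_normed_algebra,banach} \<Rightarrow> 'b::real_normed_vector"
  assumes ai: "approximates_right_identity M TYPE('a)"
    and \<psi>: "linear \<psi>" and mult: "\<And>c. bounded_linear (\<lambda>a. \<psi> (a * c))"
  shows "bounded_linear \<psi>"
proof (rule ccontr)
  interpret \<psi>: linear \<psi> by fact
  assume "\<not> bounded_linear \<psi>"
  then have "\<exists>a. norm (\<psi> a) > norm a * K" for K
    using \<psi> unfolding bounded_linear_def bounded_linear_axioms_def by (meson not_less)
  \<comment> \<open>Of the two factors \<open>Suc n\<close>, one is spent on making \<open>z\<close> a null sequence, the other keeps \<open>\<psi> (z n)\<close> unbounded.\<close>
  then have "\<forall>n. \<exists>a. norm (\<psi> a) > norm a * (real (Suc n))\<^sup>2"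
    by blast
  then obtain a where a: "\<And>n. norm (\<psi> (a n)) > norm (a n) * (real (Suc n))\<^sup>2"
    by metis
  have pos: "norm (a n) > 0" for n
    using a[of n] by (auto simp: \<psi>.zero)
  define z where "z n = inverse (real (Suc n) * norm (a n)) *\<^sub>R a n" for n
  have "norm (z n) = inverse (real (Suc n))" for n
    using pos[of n] by (simp add: z_def inverse_mult_distrib)
  then have "z \<longlonglongrightarrow> 0"
    using LIMSEQ_inverse_real_of_nat tendsto_norm_zero_iff[of z] by simp
  then obtain b c B where bc: "\<And>k. z k = b k * c" "\<And>k. norm (b k) \<le> B"
    using Cohen_factorization_null_sequence[OF ai] by metis
  obtain K where K: "K \<ge> 0" "\<And>x. norm (\<psi> (x * c)) \<le> norm x * K"
    using bounded_linear.nonneg_bounded[OF mult[of c]] by blast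
  have "real (Suc n) < B * K" for n
  proof -
    have cancel: "t = inverse (t * u) * (u * t\<^sup>2)" if "t > 0" "u > 0" for t u :: real
      using that by (simp add: field_simps power2_eq_square)
    have "real (Suc n) = inverse (real (Suc n) * norm (a n)) * (norm (a n) * (real (Suc n))\<^sup>2)"
      by (rule cancel) (use pos[of n] in auto)
    also have "\<dots> < inverse (real (Suc n) * norm (a n)) * norm (\<psi> (a n))"
      using pos[of n] a[of n] by (intro mult_strict_left_mono) auto
    also have "\<dots> = norm (\<psi> (z n))"
      using pos[of n] by (simp add: z_def \<psi>.scale)
    also have "\<dots> \<le> B * K"
      using K(2)[of "b n"] mult_right_mono[OF bc(2)[of n] K(1)] by (simp add: bc(1))
    finally show ?thesis .
  qed
  then show False
    using reals_Archimedean2[of "B * K"] by (smt (verit) of_nat_Suc)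
qed

section \<open>Components of derivations\<close>

lemma vector_space_scaleC: "vector_space (scaleC :: complex \<Rightarrow> 'a \<Rightarrow> 'a::complex_vector)"
  by unfold_locales (simp_all add: scaleC_add_right scaleC_add_left scaleC_scaleC scaleC_one)

lemma clinear_iff:
  "clinear f \<longleftrightarrow> (\<forall>x y. f (x + y) = f x + f y) \<and> (\<forall>c x. f (c *\<^sub>C x) = c *\<^sub>C f x)"
  by (simp add: Vector_Spaces.linear_iff vector_space_scaleC)

lemma clinear_imp_linear: "clinear f \<Longrightarrow> linear f"
  by (rule linearI) (simp_all add: clinear_iff scaleR_scaleC)

context compatible_banach_bimodule
begin

lemma bounded_bilinear_lact: "bounded_bilinear (\<rhd>)"
proof
  show "\<exists>K. \<forall>a x. norm (a \<rhd> x) \<le> norm a * norm x * K"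
    using norm_lact by (intro exI[of _ 1]) simp
qed (simp_all add: clinear_imp_linear[OF lact_clinear_left, THEN linear_add]
    clinear_imp_linear[OF lact_clinear_left, THEN linear_scale]
    clinear_imp_linear[OF lact_clinear_right, THEN linear_add]
    clinear_imp_linear[OF lact_clinear_right, THEN linear_scale])

lemma bounded_bilinear_ract: "bounded_bilinear (\<lhd>)"
proof
  show "\<exists>K. \<forall>x a. norm (x \<lhd> a) \<le> norm x * norm a * K"
    using norm_ract by (intro exI[of _ 1]) simp
qed (simp_all add:
    clinear_imp_linear[OF ract_clinear_left, THEN linear_add]
    clinear_imp_linear[OF ract_clinear_left, THEN linear_scale]
    clinear_imp_linear[OF ract_clinear_right, THEN linear_add]
    clinear_imp_linear[OF ract_clinear_right, THEN linear_scale])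

sublocale l: bounded_bilinear "(\<rhd>)" by (rule bounded_bilinear_lact)
sublocale r: bounded_bilinear "(\<lhd>)" by (rule bounded_bilinear_ract)

text \<open>
  If \<open>a\<close> annihilates the module, then \<open>\<phi> (a * b) = a \<rhd> \<phi> b = 0\<close>, so \<open>a * b = 0\<close> for all \<open>b\<close>; letting \<open>b\<close> run
  through an approximate identity gives \<open>a = 0\<close>.
\<close>

lemma annihilator_eq_zero_if_injective_module_hom:
  assumes ai: "approximates_right_identity M TYPE('a)"
    and \<phi>: "left_module_hom (\<rhd>) \<phi>" "inj \<phi>"
  shows "ann_alg (\<rhd>) (\<lhd>) = {0}"
proof -
  have hom: "\<phi> (a * b) = a \<rhd> \<phi> b" for a b
    using \<phi>(1) by (simp add: left_module_hom_def)
  have lin: "linear \<phi>"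
    using \<phi>(1) clinear_imp_linear by (auto simp: left_module_hom_def)
  have "a = 0" if "a \<in> ann_alg (\<rhd>) (\<lhd>)" for a
  proof (rule right_annihilated_only_zero[OF ai])
    fix b
    have "\<phi> (a * b) = \<phi> 0"
      using that by (simp add: hom ann_alg_def linear_0[OF lin])
    then show "a * b = 0"
      using \<phi>(2) by (simp add: inj_eq)
  qed
  then show ?thesis
    by (auto simp: ann_alg_def l.zero_left r.zero_right)
qed

lemma left_module_hom_bounded:
  assumes ai: "approximates_right_identity M TYPE('a)"
    and \<phi>: "left_module_hom (\<rhd>) \<phi>"
  shows "bounded_linear \<phi>"
proof (rule bounded_linear_if_bounded_on_right_multiples[OF ai])
  show "linear \<phi>"
    using \<phi> clinear_imp_linear by (auto simp: left_module_hom_def)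
  show "bounded_linear (\<lambda>a. \<phi> (a * c))" for c
    using \<phi> l.bounded_linear_left[of "\<phi> c"] by (simp add: left_module_hom_def)
qed

text \<open>
  These are the components of the Leibniz rule on products of elements of the form \<open>(a, 0)\<close> and \<open>(0, x)\<close>.
\<close>

lemma derivation_components:
  assumes D: "derivation (semidirect_mult (\<rhd>) (\<lhd>)) D"
    and lin: "linear \<delta>\<^sub>1" "linear \<delta>\<^sub>2" "linear \<tau>\<^sub>1" "linear \<tau>\<^sub>2"
    and comp: "\<And>a x. D (Semi a x) = Semi (\<delta>\<^sub>1 a + \<tau>\<^sub>1 x) (\<delta>\<^sub>2 a + \<tau>\<^sub>2 x)"
  shows "\<tau>\<^sub>2 (a \<rhd> x) = a \<rhd> \<tau>\<^sub>2 x + \<delta>\<^sub>1 a \<rhd> x + \<delta>\<^sub>2 a * x"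
    and "\<tau>\<^sub>2 (x \<lhd> a) = x \<lhd> \<delta>\<^sub>1 a + \<tau>\<^sub>2 x \<lhd> a + x * \<delta>\<^sub>2 a"
    and "\<tau>\<^sub>2 (x * y) = x \<lhd> \<tau>\<^sub>1 y + x * \<tau>\<^sub>2 y + \<tau>\<^sub>1 x \<rhd> y + \<tau>\<^sub>2 x * y"
    and "\<delta>\<^sub>2 (a * b) = a \<rhd> \<delta>\<^sub>2 b + \<delta>\<^sub>2 a \<lhd> b"
proof -
  let ?m = "semidirect_mult (\<rhd>) (\<lhd>)"
  have leibniz: "D (?m p q) = ?m p (D q) + ?m (D p) q" for p q
    using D by (simp add: derivation_def)
  note zeros = lin[THEN linear_0] l.zero_left l.zero_right r.zero_left r.zero_right
  note expand = comp semidirect_mult_def plus_semidirect_def zeros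
  show "\<tau>\<^sub>2 (a \<rhd> x) = a \<rhd> \<tau>\<^sub>2 x + \<delta>\<^sub>1 a \<rhd> x + \<delta>\<^sub>2 a * x"
    using leibniz[of "Semi a 0" "Semi 0 x"] by (simp add: expand add.assoc)
  show "\<tau>\<^sub>2 (x \<lhd> a) = x \<lhd> \<delta>\<^sub>1 a + \<tau>\<^sub>2 x \<lhd> a + x * \<delta>\<^sub>2 a"
    using leibniz[of "Semi 0 x" "Semi a 0"] by (simp add: expand add_ac)
  show "\<tau>\<^sub>2 (x * y) = x \<lhd> \<tau>\<^sub>1 y + x * \<tau>\<^sub>2 y + \<tau>\<^sub>1 x \<rhd> y + \<tau>\<^sub>2 x * y"
    using leibniz[of "Semi 0 x" "Semi 0 y"] by (simp add: expand add.assoc)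
  show "\<delta>\<^sub>2 (a * b) = a \<rhd> \<delta>\<^sub>2 b + \<delta>\<^sub>2 a \<lhd> b"
    using leibniz[of "Semi a 0" "Semi b 0"] by (simp add: expand)
qed

text \<open>
  Each identity expresses the image of \<open>\<delta>\<close> or \<open>\<tau>\<^sub>1\<close>, once it acts on the module, through continuous
  maps.  Hence a limit \<open>b\<close> of images of a null sequence acts as zero on both sides, so it vanishes,
  and the closed graph theorem applies.
\<close>

lemma bounded_components_if_annihilator_zero:
  assumes ann: "ann_alg (\<rhd>) (\<lhd>) = {0}"
    and lin: "linear \<delta>" "linear \<tau>\<^sub>1" and \<tau>\<^sub>2: "bounded_linear \<tau>\<^sub>2"
    and left: "\<And>a x. \<tau>\<^sub>2 (a \<rhd> x) = a \<rhd> \<tau>\<^sub>2 x + \<delta> a \<rhd> x"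
    and right: "\<And>a x. \<tau>\<^sub>2 (x \<lhd> a) = x \<lhd> \<delta> a + \<tau>\<^sub>2 x \<lhd> a"
    and mult: "\<And>x y. \<tau>\<^sub>2 (x * y) = x \<lhd> \<tau>\<^sub>1 y + x * \<tau>\<^sub>2 y + \<tau>\<^sub>1 x \<rhd> y + \<tau>\<^sub>2 x * y"
  shows "bounded_linear \<delta>" and "bounded_linear \<tau>\<^sub>1"
proof -
  interpret \<tau>\<^sub>2: bounded_linear \<tau>\<^sub>2 by fact
  have zero: "b = 0" if "\<And>x. b \<rhd> x = 0" "\<And>x. x \<lhd> b = 0" for b
    using ann that by (auto simp: ann_alg_def)
  show "bounded_linear \<delta>"
  proof (rule closed_graph[OF lin(1)])
    fix A b assume A: "A \<longlonglongrightarrow> 0" and b: "(\<lambda>n. \<delta> (A n)) \<longlonglongrightarrow> b"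
    show "b = 0"
    proof (rule zero)
      fix x
      have "(\<lambda>n. \<tau>\<^sub>2 (A n \<rhd> x) - A n \<rhd> \<tau>\<^sub>2 x) \<longlonglongrightarrow> \<tau>\<^sub>2 (0 \<rhd> x) - 0 \<rhd> \<tau>\<^sub>2 x"
        by (intro tendsto_diff \<tau>\<^sub>2.tendsto l.tendsto tendsto_const A)
      moreover have "(\<lambda>n. \<tau>\<^sub>2 (A n \<rhd> x) - A n \<rhd> \<tau>\<^sub>2 x) \<longlonglongrightarrow> b \<rhd> x"
        unfolding left add_diff_cancel_left' by (intro l.tendsto tendsto_const b)
      ultimately show "b \<rhd> x = 0"
        using LIMSEQ_unique by (fastforce simp: l.zero_left \<tau>\<^sub>2.zero)
      have "(\<lambda>n. \<tau>\<^sub>2 (x \<lhd> A n) - \<tau>\<^sub>2 x \<lhd> A n) \<longlonglongrightarrow> \<tau>\<^sub>2 (x \<lhd> 0) - \<tau>\<^sub>2 x \<lhd> 0"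
        by (intro tendsto_diff \<tau>\<^sub>2.tendsto r.tendsto tendsto_const A)
      moreover have "(\<lambda>n. \<tau>\<^sub>2 (x \<lhd> A n) - \<tau>\<^sub>2 x \<lhd> A n) \<longlonglongrightarrow> x \<lhd> b"
        unfolding right add_diff_cancel_right' by (intro r.tendsto tendsto_const b)
      ultimately show "x \<lhd> b = 0"
        using LIMSEQ_unique by (fastforce simp: r.zero_right \<tau>\<^sub>2.zero)
    qed
  qed
  show "bounded_linear \<tau>\<^sub>1"
  proof (rule closed_graph[OF lin(2)])
    fix X b assume X: "X \<longlonglongrightarrow> 0" and b: "(\<lambda>n. \<tau>\<^sub>1 (X n)) \<longlonglongrightarrow> b"
    show "b = 0"
    proof (rule zero)
      fix y
      have "(\<lambda>n. \<tau>\<^sub>2 (X n * y) - X n \<lhd> \<tau>\<^sub>1 y - X n * \<tau>\<^sub>2 y - \<tau>\<^sub>2 (X n) * y)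
          \<longlonglongrightarrow> \<tau>\<^sub>2 (0 * y) - 0 \<lhd> \<tau>\<^sub>1 y - 0 * \<tau>\<^sub>2 y - \<tau>\<^sub>2 0 * y"
        by (intro tendsto_diff \<tau>\<^sub>2.tendsto r.tendsto tendsto_mult tendsto_const X)
      moreover have "(\<lambda>n. \<tau>\<^sub>1 (X n) \<rhd> y) \<longlonglongrightarrow> b \<rhd> y"
        by (intro l.tendsto tendsto_const b)
      ultimately show "b \<rhd> y = 0"
        using LIMSEQ_unique by (fastforce simp: mult r.zero_left \<tau>\<^sub>2.zero)
      have "(\<lambda>n. \<tau>\<^sub>2 (y * X n) - y * \<tau>\<^sub>2 (X n) - \<tau>\<^sub>1 y \<rhd> X n - \<tau>\<^sub>2 y * X n)
          \<longlonglongrightarrow> \<tau>\<^sub>2 (y * 0) - y * \<tau>\<^sub>2 0 - \<tau>\<^sub>1 y \<rhd> 0 - \<tau>\<^sub>2 y * 0"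
        by (intro tendsto_diff \<tau>\<^sub>2.tendsto l.tendsto tendsto_mult tendsto_const X)
      moreover have "(\<lambda>n. y \<lhd> \<tau>\<^sub>1 (X n)) \<longlonglongrightarrow> y \<lhd> b"
        by (intro r.tendsto tendsto_const b)
      ultimately show "y \<lhd> b = 0"
        using LIMSEQ_unique by (fastforce simp: mult l.zero_right \<tau>\<^sub>2.zero)
    qed
  qed
qed

text \<open>
  Along \<open>\<phi>\<close> the rule for \<open>\<tau>\<close> becomes \<open>\<tau> (\<phi> (a * c)) = a \<rhd> \<tau> (\<phi> c) + \<delta> a \<rhd> \<phi> c\<close>, which is bounded in \<open>a\<close>
  for fixed \<open>c\<close>.  By factorization \<open>\<tau> \<circ> \<phi>\<close> is bounded, and \<open>\<phi>\<close>, being open, passes this on to \<open>\<tau>\<close>.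
\<close>

lemma bounded_component_if_surjective_module_hom:
  assumes ai: "approximates_right_identity M TYPE('a)"
    and \<phi>: "left_module_hom (\<rhd>) \<phi>" "surj \<phi>"
    and \<delta>: "bounded_linear \<delta>" and \<tau>: "linear \<tau>"
    and left: "\<And>a x. \<tau> (a \<rhd> x) = a \<rhd> \<tau> x + \<delta> a \<rhd> x"
  shows "bounded_linear \<tau>"
proof (rule bounded_linear_if_composite_with_surjection[OF _ \<phi>(2) \<tau>])
  show bl: "bounded_linear \<phi>"
    by (rule left_module_hom_bounded[OF ai \<phi>(1)])
  show "bounded_linear (\<lambda>a. \<tau> (\<phi> a))"
  proof (rule bounded_linear_if_bounded_on_right_multiples[OF ai])
    show "linear (\<lambda>a. \<tau> (\<phi> a))"
      using linear_compose[OF bounded_linear.linear[OF bl] \<tau>] by (simp add: o_def)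
    fix c
    have "(\<lambda>a. \<tau> (\<phi> (a * c))) = (\<lambda>a. a \<rhd> \<tau> (\<phi> c) + \<delta> a \<rhd> \<phi> c)"
      using \<phi>(1) by (simp add: left_module_hom_def left)
    then show "bounded_linear (\<lambda>a. \<tau> (\<phi> (a * c)))"
      by (simp add: bounded_linear_add l.bounded_linear_left
          bounded_linear_compose[OF l.bounded_linear_left \<delta>])
  qed
qed

lemma derivation_diff:
  assumes "derivation (semidirect_mult (\<rhd>) (\<lhd>)) D" "derivation (semidirect_mult (\<rhd>) (\<lhd>)) D'"
  shows "derivation (semidirect_mult (\<rhd>) (\<lhd>)) (\<lambda>p. D p - D' p)"
proof -
  let ?m = "semidirect_mult (\<rhd>) (\<lhd>)"
  have distrib: "?m p (q - q') = ?m p q - ?m p q'" "?m (p - p') q = ?m p q - ?m p' q" for p p' q q'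
    by (simp_all add: semidirect_mult_def minus_semidirect_def algebra_simps
        l.diff_left l.diff_right r.diff_left r.diff_right)
  interpret C: vector_space "scaleC :: complex \<Rightarrow> ('a, 'u) semidirect \<Rightarrow> _"
    by (rule vector_space_scaleC)
  have "clinear (\<lambda>p. D p - D' p)"
    using assms by (simp add: derivation_def clinear_iff C.scale_right_diff_distrib)
  then show ?thesis
    using assms by (simp add: derivation_def distrib)
qed

lemma derivation_of_annihilating_component:
  assumes \<delta>: "clinear \<delta>" "range \<delta> \<subseteq> ann_self" and leibniz: "\<And>a b. \<delta> (a * b) = a \<rhd> \<delta> b + \<delta> a \<lhd> b"
  shows "derivation (semidirect_mult (\<rhd>) (\<lhd>)) (\<lambda>p. Semi 0 (\<delta> (sd_fst p)))"
proof -
  interpret \<delta>: Vector_Spaces.linear scaleC scaleC \<delta> by fact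
  have ann: "\<delta> a * x = 0" "x * \<delta> a = 0" for a x
    using \<delta>(2) by (auto simp: ann_self_def)
  have "clinear (\<lambda>p :: ('a, 'u) semidirect. Semi (0 :: 'a) (\<delta> (sd_fst p)))"
    by (simp add: clinear_iff plus_semidirect_def scaleC_semidirect_def \<delta>.add \<delta>.scale)
  then show ?thesis
    by (simp add: derivation_def semidirect_mult_def plus_semidirect_def leibniz ann
        l.zero_left r.zero_right)
qed

end

lemma bounded_linear_semidirect:
  fixes \<delta> :: "'a::complex_normed_vector \<Rightarrow> 'b::complex_normed_vector"
    and \<tau>\<^sub>1 :: "'c::complex_normed_vector \<Rightarrow> 'b" and \<tau>\<^sub>2 :: "'c \<Rightarrow> 'd::complex_normed_vector"
  assumes "bounded_linear \<delta>" "bounded_linear \<tau>\<^sub>1" "bounded_linear \<tau>\<^sub>2"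
  shows "bounded_linear (\<lambda>p. Semi (\<delta> (sd_fst p) + \<tau>\<^sub>1 (sd_snd p)) (\<tau>\<^sub>2 (sd_snd p)))"
proof -
  interpret \<delta>: bounded_linear \<delta> by fact
  interpret \<tau>\<^sub>1: bounded_linear \<tau>\<^sub>1 by fact
  interpret \<tau>\<^sub>2: bounded_linear \<tau>\<^sub>2 by fact
  obtain K L M where K: "K \<ge> 0" "\<And>a. norm (\<delta> a) \<le> norm a * K"
    and L: "L \<ge> 0" "\<And>x. norm (\<tau>\<^sub>1 x) \<le> norm x * L"
    and M: "M \<ge> 0" "\<And>x. norm (\<tau>\<^sub>2 x) \<le> norm x * M"
    using \<delta>.nonneg_bounded \<tau>\<^sub>1.nonneg_bounded \<tau>\<^sub>2.nonneg_bounded by metis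
  show ?thesis
  proof (rule bounded_linear_intro)
    fix p :: "('a, 'c) semidirect"
    have "norm (\<delta> (sd_fst p) + \<tau>\<^sub>1 (sd_snd p)) + norm (\<tau>\<^sub>2 (sd_snd p))
        \<le> norm (sd_fst p) * K + norm (sd_snd p) * (L + M)"
      using norm_triangle_ineq[of "\<delta> (sd_fst p)" "\<tau>\<^sub>1 (sd_snd p)"]
        K(2)[of "sd_fst p"] L(2)[of "sd_snd p"] M(2)[of "sd_snd p"] by (simp add: distrib_left)
    also have "\<dots> \<le> norm (sd_fst p) * (K + L + M) + norm (sd_snd p) * (K + L + M)"
      using K(1) L(1) M(1) by (intro add_mono mult_left_mono) auto
    finally show "norm (Semi (\<delta> (sd_fst p) + \<tau>\<^sub>1 (sd_snd p)) (\<tau>\<^sub>2 (sd_snd p))) \<le> norm p * (K + L + M)"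
      by (simp add: norm_semidirect_def distrib_right)
  qed (simp_all add: plus_semidirect_def scaleR_semidirect_def \<delta>.add \<tau>\<^sub>1.add \<tau>\<^sub>2.add
      \<delta>.scaleR \<tau>\<^sub>1.scaleR \<tau>\<^sub>2.scaleR scaleR_add_right)
qed

theorem proposition3p12:
  fixes lact :: "'a::complex_banach_algebra \<Rightarrow> 'u::complex_banach_algebra \<Rightarrow> 'u"
    and ract :: "'u \<Rightarrow> 'a \<Rightarrow> 'u"
    and D :: "('a, 'u) semidirect \<Rightarrow> ('a, 'u) semidirect"
    and \<delta>\<^sub>1 :: "'a \<Rightarrow> 'a" and \<delta>\<^sub>2 :: "'a \<Rightarrow> 'u"
    and \<tau>\<^sub>1 :: "'u \<Rightarrow> 'a" and \<tau>\<^sub>2 :: "'u \<Rightarrow> 'u"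
  assumes bimodule: "compatible_banach_bimodule lact ract"
    and derivation: "derivation (semidirect_mult lact ract) D"
    and linear: "clinear \<delta>\<^sub>1" "clinear \<delta>\<^sub>2" "clinear \<tau>\<^sub>1" "clinear \<tau>\<^sub>2"
    and components: "\<And>a x. D (Semi a x) = Semi (\<delta>\<^sub>1 a + \<tau>\<^sub>1 x) (\<delta>\<^sub>2 a + \<tau>\<^sub>2 x)"
    and annihilates: "range \<delta>\<^sub>2 \<subseteq> ann_self"
    and conditions:
      "(ann_alg lact ract = {0} \<and> continuous_on UNIV \<tau>\<^sub>2) \<or>
       ((\<exists>I le (e :: 'i \<Rightarrow> 'a). bounded_right_approx_identity I le e) \<and>
        (\<exists>\<phi>. left_module_hom lact \<phi> \<and> surj \<phi>) \<and>
        continuous_on UNIV \<delta>\<^sub>1 \<and> continuous_on UNIV \<tau>\<^sub>1) \<or>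
       ((\<exists>I le (e :: 'j \<Rightarrow> 'a). bounded_right_approx_identity I le e) \<and>
        (\<exists>\<phi>. left_module_hom lact \<phi> \<and> inj \<phi>) \<and>
        continuous_on UNIV \<tau>\<^sub>1 \<and> continuous_on UNIV \<tau>\<^sub>2)"
  shows "let D\<^sub>1 = (\<lambda>p. Semi (\<delta>\<^sub>1 (sd_fst p) + \<tau>\<^sub>1 (sd_snd p)) (\<tau>\<^sub>2 (sd_snd p)));
             D\<^sub>2 = (\<lambda>p. Semi 0 (\<delta>\<^sub>2 (sd_fst p)))
         in derivation (semidirect_mult lact ract) D\<^sub>1 \<and> continuous_on UNIV D\<^sub>1 \<and>
            derivation (semidirect_mult lact ract) D\<^sub>2 \<and>
            D = (\<lambda>p. D\<^sub>1 p + D\<^sub>2 p)"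
proof -
  interpret compatible_banach_bimodule lact ract by (rule bimodule)
  note lin = linear[THEN clinear_imp_linear]
  have ann: "\<delta>\<^sub>2 a * x = 0" "x * \<delta>\<^sub>2 a = 0" for a x
    using annihilates by (auto simp: ann_self_def)
  note comps = derivation_components[OF derivation lin components, unfolded ann add_0_right]
  have bounded: "bounded_linear \<delta>\<^sub>1 \<and> bounded_linear \<tau>\<^sub>1 \<and> bounded_linear \<tau>\<^sub>2"
    using conditions
  proof (elim disjE conjE exE)
    assume "ann_alg lact ract = {0}" "continuous_on UNIV \<tau>\<^sub>2"
    then show ?thesis
      using bounded_components_if_annihilator_zero[OF _ lin(1) lin(3) _ comps(1-3)]
        bounded_linear_if_continuous[OF lin(4)] by blast
  next
    fix I le \<phi> and e :: "'i \<Rightarrow> 'a"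
    assume "bounded_right_approx_identity I le e" and \<phi>: "left_module_hom lact \<phi>" "surj \<phi>"
      and cont: "continuous_on UNIV \<delta>\<^sub>1" "continuous_on UNIV \<tau>\<^sub>1"
    then obtain M where M: "approximates_right_identity M TYPE('a)"
      using approximates_right_identity_if_net by blast
    have "bounded_linear \<delta>\<^sub>1" "bounded_linear \<tau>\<^sub>1"
      using bounded_linear_if_continuous lin cont by blast+
    then show ?thesis
      using bounded_component_if_surjective_module_hom[OF M \<phi> _ lin(4) comps(1)] by blast
  next
    fix I le \<phi> and e :: "'j \<Rightarrow> 'a"
    assume "bounded_right_approx_identity I le e" and \<phi>: "left_module_hom lact \<phi>" "inj \<phi>"
      and cont: "continuous_on UNIV \<tau>\<^sub>2"
    then obtain M where "approximates_right_identity M TYPE('a)"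
      using approximates_right_identity_if_net by blast
    then have "ann_alg lact ract = {0}"
      using annihilator_eq_zero_if_injective_module_hom \<phi> by blast
    then show ?thesis
      using bounded_components_if_annihilator_zero[OF _ lin(1) lin(3) _ comps(1-3)]
        bounded_linear_if_continuous[OF lin(4) cont] by blast
  qed
  let ?D1 = "\<lambda>p. Semi (\<delta>\<^sub>1 (sd_fst p) + \<tau>\<^sub>1 (sd_snd p)) (\<tau>\<^sub>2 (sd_snd p))"
  let ?D2 = "\<lambda>p. Semi 0 (\<delta>\<^sub>2 (sd_fst p)) :: ('a, 'u) semidirect"
  have D: "D p = Semi (\<delta>\<^sub>1 (sd_fst p) + \<tau>\<^sub>1 (sd_snd p)) (\<delta>\<^sub>2 (sd_fst p) + \<tau>\<^sub>2 (sd_snd p))" for p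
    using components[of "sd_fst p" "sd_snd p"] by simp
  have D2: "derivation (semidirect_mult lact ract) ?D2"
    by (rule derivation_of_annihilating_component[OF linear(2) annihilates comps(4)])
  have "?D1 = (\<lambda>p. D p - ?D2 p)"
    by (simp add: D minus_semidirect_def)
  then have "derivation (semidirect_mult lact ract) ?D1"
    using derivation_diff[OF derivation D2] by simp
  moreover have "continuous_on UNIV ?D1"
    using bounded_linear_semidirect bounded linear_continuous_on by blast
  moreover have "D = (\<lambda>p. ?D1 p + ?D2 p)"
    by (simp add: fun_eq_iff D plus_semidirect_def add.commute)
  ultimately show ?thesis
    using D2 by (simp add: Let_def)
qed

end
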